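(* Let $D=\prod_{i=1}^d[a_i,b_i]$ with $a_i<b_i$, let $\mathbf v\subseteq[d]$ and let $f\in C^{|\mathbf v|}(D)$. Then for every $\mathbf u$ with $\mathbf v\subseteq\mathbf u\subseteq[d]$ the following estimates hold for the summands of the anchored decomposition (with anchor point $c\in D$) and of the ANOVA decomposition of $f$: (i) $\|f_{\mathbf u,c}\|_\infty\le 2^{|\mathbf u|-|\mathbf v|}\,\|\partial_{\mathbf v}f\|_\infty\,\lambda_{\mathbf v}(D_{\mathbf v})$; (ii) $\|f_{\mathbf u,A}\|_\infty\le 2^{|\mathbf u|-|\mathbf v|}\,\|\partial_{\mathbf v}f\|_\infty\,\lambda(D)\,\lambda_{\mathbf v}(D_{\mathbf v})$; (iii) $\|f_{\mathbf u,A}\|_1\le 2^{|\mathbf u|-|\mathbf v|}\,\|\partial_{\mathbf v}f\|_1\,\lambda_{\mathbf u}(D_{\mathbf u})\,\lambda_{\mathbf v}(D_{\mathbf v})$, where, for each $\mathbf w\subseteq[d]$, $\lambda_{\mathbf w}$ denotes the normalized Lebesgue measure on $D_{\mathbf w}$, and $\lambda=\lambda_{[d]}$.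
   Context: $[d]=\{1,\dots,d\}$; for $\mathbf u=\{i_1,\dots,i_k\}\subseteq[d]$: $x_{\mathbf u}=(x_i)_{i\in\mathbf u}$, $D_{\mathbf u}=\prod_{i\in\mathbf u}[a_i,b_i]$, and $\partial_{\mathbf u}=\partial^{k}_{x_{i_1},\dots,x_{i_k}}$ is the mixed partial derivative, once in each variable of $\mathbf u$ ($\partial_\emptyset f=f$). Anchored projections: for $c\in D$, $P_{i,c}f(x)=f(x_1,\dots,x_{i-1},c_i,x_{i+1},\dots,x_d)$. ANOVA projections: $P_{i,A}f=\frac1{b_i-a_i}\int_{a_i}^{b_i}f\,dx_i$. The anchored and ANOVA summands are $$f_{\mathbf u,c}=\prod_{j\in\mathbf u}(\mathrm{Id}-P_{j,c})\prod_{j\in[d]\setminus\mathbf u}P_{j,c}f,\qquad f_{\mathbf u,A}=\prod_{j\in\mathbf u}(\mathrm{Id}-P_{j,A})\prod_{j\in[d]\setminus\mathbf u}P_{j,A}f,$$ and they depend only on $x_{\mathbf u}$. $\|\cdot\|_\infty$ is the supremum norm, and $\|\cdot\|_1$ is the $L^1$-norm with respect to the normalized Lebesgue measure on $D_{\mathbf u}$ (for $f_{\mathbf u,A}$) respectively on $D$ (for $\partial_{\mathbf v}f$).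
   Formalization: The factor λ_v(D_v) is taken as the ordinary volume ∏_{i∈v}(b_i−a_i), while λ(D), λ_u(D_u) and the L¹-norms stay normalized; with λ_v(D_v)=1, (i) fails for D=[0,2], f(x)=x, c=0, u=v={1}. *)

theory Defs
  imports "HOL-Analysis.Analysis"
begin

text \<open>
  The index set \<open>[d]\<close> is \<open>{1..d}\<close>.  A point of \<open>D\<^sub>w = (\<Prod>i\<in>w. [a\<^sub>i, b\<^sub>i])\<close>, for
  \<open>w \<subseteq> {1..d}\<close>, is an extensional function on \<open>w\<close>, so that \<open>D = D\<^sub>{\<^sub>1\<^sub>.\<^sub>.\<^sub>d\<^sub>}\<close> and all the lower
  dimensional boxes live in the same type.  Functions on \<open>D\<close> are total functions of which only the
  values on \<open>D\<close> matter.
\<close>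

type_synonym point = "nat \<Rightarrow> real"

definition subbox :: "point \<Rightarrow> point \<Rightarrow> nat set \<Rightarrow> point set" where
  "subbox a b w = (\<Pi>\<^sub>E i\<in>w. {a i..b i})"


subsection \<open>Mixed derivatives and the class \<open>C\<^sup>k(D)\<close>\<close>

text \<open>The derivative along \<open>x\<^sub>i\<close> is taken relative to \<open>[a\<^sub>i, b\<^sub>i]\<close>, i.e. it is one-sided on the
  two faces of \<open>D\<close> orthogonal to the \<open>i\<close>-th axis.\<close>

definition partial_deriv ::
    "point \<Rightarrow> point \<Rightarrow> nat \<Rightarrow> (point \<Rightarrow> real) \<Rightarrow> point \<Rightarrow> real" where
  "partial_deriv a b i f x =
     vector_derivative (\<lambda>t. f (x(i := t))) (at (x i) within {a i..b i})"

primrec C_k :: "nat \<Rightarrow> nat \<Rightarrow> point \<Rightarrow> point \<Rightarrow> (point \<Rightarrow> real) \<Rightarrow> bool" where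
  "C_k 0 d a b f \<longleftrightarrow> continuous_on (subbox a b {1..d}) f"
| "C_k (Suc k) d a b f \<longleftrightarrow>
     continuous_on (subbox a b {1..d}) f \<and>
     (\<forall>i\<in>{1..d}.
        (\<forall>x\<in>subbox a b {1..d}.
           (\<lambda>t. f (x(i := t))) differentiable (at (x i) within {a i..b i})) \<and>
        C_k k d a b (partial_deriv a b i f))"

text \<open>\<open>compose_over T {i\<^sub>1 < \<dots> < i\<^sub>k} = T i\<^sub>1 \<circ> \<dots> \<circ> T i\<^sub>k\<close>.  In all uses below the
  factors commute on the functions in question, so the order is only a convention.\<close>

definition compose_over :: "(nat \<Rightarrow> 'f \<Rightarrow> 'f) \<Rightarrow> nat set \<Rightarrow> 'f \<Rightarrow> 'f" where
  "compose_over T w = foldr T (sorted_list_of_set w)"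

definition mixed_deriv ::
    "point \<Rightarrow> point \<Rightarrow> nat set \<Rightarrow> (point \<Rightarrow> real) \<Rightarrow> point \<Rightarrow> real" where
  "mixed_deriv a b v = compose_over (partial_deriv a b) v"


subsection \<open>Anchored and ANOVA decompositions\<close>

definition proj_anchored :: "point \<Rightarrow> nat \<Rightarrow> (point \<Rightarrow> real) \<Rightarrow> point \<Rightarrow> real" where
  "proj_anchored c i f x = f (x(i := c i))"

definition proj_anova :: "point \<Rightarrow> point \<Rightarrow> nat \<Rightarrow> (point \<Rightarrow> real) \<Rightarrow> point \<Rightarrow> real" where
  "proj_anova a b i f x = 1 / (b i - a i) * (LINT t:{a i..b i}|lborel. f (x(i := t)))"

definition summand ::
    "(nat \<Rightarrow> (point \<Rightarrow> real) \<Rightarrow> point \<Rightarrow> real) \<Rightarrow> nat \<Rightarrow> nat set \<Rightarrow>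
      (point \<Rightarrow> real) \<Rightarrow> point \<Rightarrow> real" where
  "summand P d u f =
     compose_over (\<lambda>j g x. g x - P j g x) u (compose_over P ({1..d} - u) f)"

definition summand_anchored ::
    "nat \<Rightarrow> point \<Rightarrow> nat set \<Rightarrow> (point \<Rightarrow> real) \<Rightarrow> point \<Rightarrow> real" where
  "summand_anchored d c = summand (proj_anchored c) d"

definition summand_anova ::
    "nat \<Rightarrow> point \<Rightarrow> point \<Rightarrow> nat set \<Rightarrow> (point \<Rightarrow> real) \<Rightarrow> point \<Rightarrow> real" where
  "summand_anova d a b = summand (proj_anova a b) d"

text \<open>A function on \<open>D\<close> depending only on \<open>x\<^sub>u\<close>, regarded as a function on \<open>D\<^sub>u\<close>: the
  coordinates outside \<open>u\<close> are filled in from the corner \<open>a\<close>.  That this choice does not matter for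
  the summands is shown at the end of this theory.\<close>

definition on_subbox ::
    "nat \<Rightarrow> point \<Rightarrow> nat set \<Rightarrow> (point \<Rightarrow> real) \<Rightarrow> point \<Rightarrow> real" where
  "on_subbox d a u g y = g (merge u ({1..d} - u) (y, a))"


subsection \<open>Measures and norms\<close>

text \<open>
  Two normalizations of Lebesgue measure are involved, and they must not be confused when the sides
  of \<open>D\<close> do not have length 1.  Averages over \<open>D\<^sub>w\<close> (the ANOVA projections, the
  \<open>L\<^sup>1\<close>-norms) refer to the probability measure \<open>normalized_lebesgue\<close>, whereas a factor
  that arises from integrating \<open>\<partial>\<^sub>v f\<close> back up along the sides of \<open>D\<^sub>v\<close> is the
  ordinary volume \<open>(\<Prod>i\<in>v. b\<^sub>i - a\<^sub>i)\<close>, i.e. the measure of \<open>D\<^sub>v\<close> under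
  \<open>lebesgue_on_coords\<close>, in which unit cubes have measure 1.
\<close>

definition lebesgue_on_coords :: "nat set \<Rightarrow> point measure" where
  "lebesgue_on_coords w = (\<Pi>\<^sub>M i\<in>w. lborel)"

definition normalized_lebesgue :: "point \<Rightarrow> point \<Rightarrow> nat set \<Rightarrow> point measure" where
  "normalized_lebesgue a b w = uniform_measure (lebesgue_on_coords w) (subbox a b w)"

text \<open>Norms take values in \<open>[0, \<infinity>]\<close>, so that no boundedness or integrability is
  tacitly presupposed.\<close>

definition sup_norm :: "point set \<Rightarrow> (point \<Rightarrow> real) \<Rightarrow> ennreal" where
  "sup_norm X g = (SUP x\<in>X. ennreal \<bar>g x\<bar>)"

definition L1_norm :: "point measure \<Rightarrow> (point \<Rightarrow> real) \<Rightarrow> ennreal" where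
  "L1_norm M g = (\<integral>\<^sup>+x. ennreal \<bar>g x\<bar> \<partial>M)"


lemma emeasure_lebesgue_on_coords_subbox:
  assumes "finite w" "\<And>i. i \<in> w \<Longrightarrow> a i \<le> b i"
  shows "emeasure (lebesgue_on_coords w) (subbox a b w) = (\<Prod>i\<in>w. ennreal (b i - a i))"
proof -
  interpret product_sigma_finite "\<lambda>_. lborel :: real measure"
    by standard
  show ?thesis
    unfolding lebesgue_on_coords_def subbox_def
    using assms by (subst emeasure_PiM) auto
qed

lemma emeasure_normalized_lebesgue_subbox:
  assumes "finite w" "\<And>i. i \<in> w \<Longrightarrow> a i < b i"
  shows "emeasure (normalized_lebesgue a b w) (subbox a b w) = 1"
proof -
  have eq: "emeasure (lebesgue_on_coords w) (subbox a b w) = (\<Prod>i\<in>w. ennreal (b i - a i))"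
    using assms by (intro emeasure_lebesgue_on_coords_subbox) (auto intro: less_imp_le)
  have "(\<Prod>i\<in>w. ennreal (b i - a i)) = ennreal (\<Prod>i\<in>w. b i - a i)"
    using assms by (intro prod_ennreal) (auto intro: less_imp_le)
  moreover have "0 < (\<Prod>i\<in>w. b i - a i)"
    using assms by (intro prod_pos) auto
  ultimately have pos: "emeasure (lebesgue_on_coords w) (subbox a b w) \<noteq> 0"
    and fin: "emeasure (lebesgue_on_coords w) (subbox a b w) \<noteq> \<infinity>"
    unfolding eq by auto
  have "subbox a b w \<in> sets (lebesgue_on_coords w)"
    unfolding lebesgue_on_coords_def subbox_def
    using assms(1) by (intro sets_PiM_I_finite) auto
  then have "emeasure (normalized_lebesgue a b w) (subbox a b w) =
      emeasure (lebesgue_on_coords w) (subbox a b w)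
        / emeasure (lebesgue_on_coords w) (subbox a b w)"
    unfolding normalized_lebesgue_def by (subst emeasure_uniform_measure) auto
  then show ?thesis
    using pos fin by (simp add: ennreal_divide_self less_top)
qed


subsection \<open>The summands depend only on \<open>x\<^sub>u\<close>\<close>

definition indep_of :: "nat \<Rightarrow> (point \<Rightarrow> real) \<Rightarrow> bool" where
  "indep_of k g \<longleftrightarrow> (\<forall>x s. g (x(k := s)) = g x)"

lemma summand_indep_of:
  assumes self: "\<And>j g. indep_of j (P j g)"
    and pres: "\<And>j k g. indep_of k g \<Longrightarrow> indep_of k (P j g)"
    and k: "k \<in> {1..d} - u"
  shows "indep_of k (summand P d u f)"
proof -
  have inner: "indep_of k (foldr P js g)" if "k \<in> set js" for js g
    using that by (induction js) (auto intro: self pres)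
  have outer: "indep_of k (foldr (\<lambda>j g x. g x - P j g x) js g)" if "indep_of k g" for js g
  proof (induction js)
    case (Cons j js)
    then show ?case
      using pres[OF Cons, of j] by (simp add: indep_of_def)
  qed (use that in simp)
  show ?thesis
    unfolding summand_def compose_over_def
    by (intro outer inner) (use k in simp)
qed

lemma eq_if_indep_of:
  assumes "finite w" and "\<And>k. k \<in> w \<Longrightarrow> indep_of k g" and "\<And>i. i \<notin> w \<Longrightarrow> x i = y i"
  shows "g x = g y"
  using assms
proof (induction w arbitrary: x rule: finite_induct)
  case empty
  then have "x = y" by auto
  then show ?case by simp
next
  case (insert k w)
  have "g (x(k := y k)) = g y"
    using insert.prems by (intro insert.IH) auto
  then show ?case
    using insert.prems(1)[of k] by (simp add: indep_of_def)
qed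

lemma summand_cong:
  assumes "\<And>j g. indep_of j (P j g)"
    and "\<And>j k g. indep_of k g \<Longrightarrow> indep_of k (P j g)"
    and "x \<in> subbox a b {1..d}" "y \<in> subbox a b {1..d}" "\<And>i. i \<in> u \<Longrightarrow> x i = y i"
  shows "summand P d u f x = summand P d u f y"
proof (rule eq_if_indep_of[where w = "{1..d} - u" and g = "summand P d u f"])
  show "indep_of k (summand P d u f)" if "k \<in> {1..d} - u" for k
    using that by (intro summand_indep_of assms(1,2))
  show "x i = y i" if "i \<notin> {1..d} - u" for i
  proof (cases "i \<in> u")
    case False
    then have "i \<notin> {1..d}" using that by blast
    then show ?thesis
      using assms(3,4) unfolding subbox_def by (metis PiE_arb)
  qed (rule assms(5))
qed simp

lemma indep_of_proj_anchored:
  "indep_of j (proj_anchored c j g)"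
  "indep_of k g \<Longrightarrow> indep_of k (proj_anchored c j g)"
   apply (simp add: indep_of_def proj_anchored_def)
  apply (cases "k = j")
   apply (simp_all add: indep_of_def proj_anchored_def fun_upd_twist[of k j])
  done

lemma indep_of_proj_anova:
  "indep_of j (proj_anova a b j g)"
  "indep_of k g \<Longrightarrow> indep_of k (proj_anova a b j g)"
   apply (simp add: indep_of_def proj_anova_def)
  apply (cases "k = j")
   apply (simp_all add: indep_of_def proj_anova_def fun_upd_twist[of k j])
  done

lemma summand_anchored_cong:
  assumes "x \<in> subbox a b {1..d}" "y \<in> subbox a b {1..d}" "\<And>i. i \<in> u \<Longrightarrow> x i = y i"
  shows "summand_anchored d c u f x = summand_anchored d c u f y"
  unfolding summand_anchored_def
  by (rule summand_cong[OF indep_of_proj_anchored assms])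

lemma summand_anova_cong:
  assumes "x \<in> subbox a b {1..d}" "y \<in> subbox a b {1..d}" "\<And>i. i \<in> u \<Longrightarrow> x i = y i"
  shows "summand_anova d a b u f x = summand_anova d a b u f y"
  unfolding summand_anova_def
  by (rule summand_cong[OF indep_of_proj_anova assms])

end

theory Submission
  imports Defs "HOL-Probability.Probability_Measure"
begin

text \<open>
  The anchored summand \<open>f\<^sub>u\<^sub>,\<^sub>y\<close> is a composition of commuting finite-difference and evaluation
  operators.  By the fundamental theorem of calculus, the differences in the directions
  \<open>i \<in> v\<close> cost one integral of \<open>\<bar>\<partial>\<^sub>v f\<bar>\<close> over \<open>D\<^sub>v\<close>, which is the volume of \<open>D\<^sub>v\<close> times an
  average; expanding the differences in the remaining directions of \<open>u\<close> bounds
  \<open>\<bar>f\<^sub>u\<^sub>,\<^sub>y(x)\<bar>\<close> by a sum of \<open>2 ^ (\<bar>u\<bar> - \<bar>v\<bar>)\<close> such terms, each evaluated at a point mixed from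
  the coordinates of \<open>x\<close> and \<open>y\<close>.  This gives (i).  The ANOVA summand is the average of
  \<open>f\<^sub>u\<^sub>,\<^sub>y\<close> over all anchors \<open>y\<close>, which gives (ii).  For (iii), mixing the coordinates of
  independent uniformly distributed points yields a uniformly distributed point, so every one of
  these terms has mean \<open>\<parallel>\<partial>\<^sub>v f\<parallel>\<^sub>1\<close> times the volume.
\<close>

section \<open>Summands as products of one-variable factors\<close>

text \<open>One operator covers \<open>Id - P\<close> for directions in u and \<open>P\<close>
  elsewhere. A summand is then a single fold over all coordinates, so one reordering and one
  induction treat both kinds of factor at once.\<close>

definition summand_factor ::
    "(nat \<Rightarrow> (point \<Rightarrow> real) \<Rightarrow> point \<Rightarrow> real) \<Rightarrow> nat set \<Rightarrow> nat \<Rightarrow>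
      (point \<Rightarrow> real) \<Rightarrow> point \<Rightarrow> real" where
  "summand_factor P u j g x = (if j \<in> u then g x - P j g x else P j g x)"

lemma summand_eq_foldr:
  assumes "finite u"
  shows "summand P d u f =
    foldr (summand_factor P u) (sorted_list_of_set u @ sorted_list_of_set ({1..d} - u)) f"
proof -
  have "foldr (summand_factor P u) (sorted_list_of_set ({1..d} - u)) f
      = foldr P (sorted_list_of_set ({1..d} - u)) f"
    by (intro foldr_cong) (auto simp: summand_factor_def fun_eq_iff)
  moreover have "foldr (summand_factor P u) (sorted_list_of_set u) g
      = foldr (\<lambda>j g x. g x - P j g x) (sorted_list_of_set u) g" for g
    using assms by (intro foldr_cong) (auto simp: summand_factor_def fun_eq_iff)
  ultimately show ?thesis
    by (simp add: summand_def compose_over_def)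
qed

lemma foldr_summand_factor_Cons:
  "foldr (summand_factor P u) (j # js) g x = (if j \<in> u
     then foldr (summand_factor P u) js g x - P j (foldr (summand_factor P u) js g) x
     else P j (foldr (summand_factor P u) js g) x)"
  by (simp add: summand_factor_def)

section \<open>Algebra of the anchored factors\<close>

abbreviation anchored_factor where
  "anchored_factor y \<equiv> summand_factor (proj_anchored y)"

lemma anchored_factor_apply:
  "anchored_factor y u j g x = (if j \<in> u then g x - g (x(j := y j)) else g (x(j := y j)))"
  by (simp add: summand_factor_def proj_anchored_def)

lemma foldr_anchored_factor_Cons:
  "foldr (anchored_factor y u) (j # js) g x = (if j \<in> u
     then foldr (anchored_factor y u) js g x - foldr (anchored_factor y u) js g (x(j := y j))
     else foldr (anchored_factor y u) js g (x(j := y j)))"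
  by (simp add: anchored_factor_apply)

text \<open>Each factor only combines values of its argument at updated points, and updates of
  distinct coordinates commute.\<close>

lemma anchored_factor_commute:
  "anchored_factor y u i \<circ> anchored_factor y u j = anchored_factor y u j \<circ> anchored_factor y u i"
proof (cases "i = j")
  case False
  then show ?thesis
    by (auto simp: fun_eq_iff anchored_factor_apply fun_upd_twist[OF False])
qed simp

lemma foldr_anchored_factor_perm:
  assumes "distinct xs" "distinct ys" "set xs = set ys"
  shows "foldr (anchored_factor y u) xs = foldr (anchored_factor y u) ys"
proof -
  have "fold (anchored_factor y u) (rev xs) = fold (anchored_factor y u) (rev ys)"
    by (rule fold_multiset_equiv[OF anchored_factor_commute])
      (use assms in \<open>simp add: set_eq_iff_mset_eq_distinct\<close>)
  then show ?thesis by (simp add: foldr_conv_fold)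
qed

text \<open>The order is chosen for the estimate: the differences in v act on f first, where the
  fundamental theorem of calculus applies; those in u - v come next and are expanded; the
  projections are outermost and merely fix coordinates.\<close>

lemma summand_anchored_eq_foldr:
  assumes "v \<subseteq> u" "finite u"
  shows "summand_anchored d y u f =
    foldr (anchored_factor y u) (sorted_list_of_set ({1..d} - u))
      (foldr (anchored_factor y u) (sorted_list_of_set (u - v))
        (foldr (anchored_factor y u) (sorted_list_of_set v) f))"
proof -
  have "finite v" using assms finite_subset by blast
  have "foldr (anchored_factor y u) (sorted_list_of_set u @ sorted_list_of_set ({1..d} - u)) =
    foldr (anchored_factor y u) (sorted_list_of_set ({1..d} - u) @ sorted_list_of_set (u - v)
       @ sorted_list_of_set v)"
    using assms \<open>finite v\<close> by (intro foldr_anchored_factor_perm) auto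
  then show ?thesis
    using assms(2) by (simp add: summand_anchored_def summand_eq_foldr)
qed

text \<open>Commutation pulls the innermost difference to the outside. What results is an increment,
  in the variable j alone, of one fixed function.\<close>

lemma foldr_anchored_factor_upd:
  assumes "j \<in> u"
  shows "foldr (anchored_factor y u) js (anchored_factor y u j g) x
    = foldr (anchored_factor y u) js g x - foldr (anchored_factor y u) js g (x(j := y j))"
proof -
  have "foldr (anchored_factor y u) js (anchored_factor y u j g)
      = anchored_factor y u j (foldr (anchored_factor y u) js g)"
  proof (induction js)
    case (Cons i js)
    then show ?case
      using fun_cong[OF anchored_factor_commute[of y u i j]] by simp
  qed simp
  then show ?thesis
    using assms by (simp add: anchored_factor_apply)
qed

lemma foldr_anchored_proj:
  assumes "set js \<inter> u = {}"
  shows "foldr (anchored_factor y u) js g x = g (\<lambda>i. if i \<in> set js then y i else x i)"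
  using assms
proof (induction js arbitrary: x)
  case (Cons j js)
  then have "foldr (anchored_factor y u) (j # js) g x = foldr (anchored_factor y u) js g (x(j := y j))"
    by (simp add: anchored_factor_apply)
  also have "\<dots> = g (\<lambda>i. if i \<in> set js then y i else (x(j := y j)) i)"
    using Cons by auto
  also have "(\<lambda>i. if i \<in> set js then y i else (x(j := y j)) i)
      = (\<lambda>i. if i \<in> set (j # js) then y i else x i)"
    by auto
  finally show ?case .
qed simp

text \<open>By the triangle inequality each difference doubles the number of terms; w records the
  directions in which a term is evaluated at the anchor.\<close>

lemma foldr_anchored_diff_le:
  assumes "set js \<subseteq> u" "distinct js"
  shows "\<bar>foldr (anchored_factor y u) js g x\<bar>
    \<le> (\<Sum>w\<in>Pow (set js). \<bar>g (\<lambda>i. if i \<in> w then y i else x i)\<bar>)"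
  using assms
proof (induction js arbitrary: x)
  case (Cons j js)
  define h where "h w = \<bar>g (\<lambda>i. if i \<in> w then y i else x i)\<bar>" for w
  have "\<bar>foldr (anchored_factor y u) (j # js) g x\<bar>
      \<le> \<bar>foldr (anchored_factor y u) js g x\<bar> + \<bar>foldr (anchored_factor y u) js g (x(j := y j))\<bar>"
    using Cons.prems by (simp add: anchored_factor_apply)
  also have "\<dots> \<le> (\<Sum>w\<in>Pow (set js). h w)
      + (\<Sum>w\<in>Pow (set js). \<bar>g (\<lambda>i. if i \<in> w then y i else (x(j := y j)) i)\<bar>)"
    unfolding h_def using Cons.prems by (intro add_mono Cons.IH) auto
  \<comment> \<open>Evaluating at the updated point amounts to adding j to the set of anchored
    directions.\<close>
  also have "(\<Sum>w\<in>Pow (set js). \<bar>g (\<lambda>i. if i \<in> w then y i else (x(j := y j)) i)\<bar>)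
      = (\<Sum>w\<in>Pow (set js). h (insert j w))"
    unfolding h_def by (intro sum.cong refl arg_cong[of _ _ "\<lambda>z. \<bar>g z\<bar>"]) auto
  also have "\<dots> = (\<Sum>w\<in>insert j ` Pow (set js). h w)"
    using Cons.prems by (subst sum.reindex) (auto simp: inj_on_def)
  also have "(\<Sum>w\<in>Pow (set js). h w) + \<dots> = (\<Sum>w\<in>Pow (set (j # js)). h w)"
    using Cons.prems by (subst sum.union_disjoint[symmetric]) (auto simp: Pow_insert)
  finally show ?case unfolding h_def .
qed simp

section \<open>Increments as integrals, and mixing of independent points\<close>

text \<open>After the fundamental theorem of calculus between s and t, the domain of integration is
  enlarged to the whole side, so the bound no longer depends on the two endpoints.\<close>

lemma increment_le_nn_integral:
  fixes \<phi> \<phi>' :: "real \<Rightarrow> real"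
  assumes st: "s \<in> {\<alpha>..\<beta>}" "t \<in> {\<alpha>..\<beta>}"
    and deriv: "\<And>r. r \<in> {\<alpha>..\<beta>} \<Longrightarrow> (\<phi> has_vector_derivative \<phi>' r) (at r within {\<alpha>..\<beta>})"
    and cont: "continuous_on {\<alpha>..\<beta>} \<phi>'"
  shows "ennreal \<bar>\<phi> s - \<phi> t\<bar> \<le> (\<integral>\<^sup>+r. ennreal \<bar>\<phi>' r\<bar> * indicator {\<alpha>..\<beta>} r \<partial>lborel)"
  using st
proof (induction s t rule: linorder_wlog)
  case (le s t)
  have int: "set_integrable lborel {s..t} \<phi>'"
    using le by (intro borel_integrable_atLeastAtMost' continuous_on_subset[OF cont]) auto
  have "integral\<^sup>L lborel (\<lambda>r. indicator {s..t} r *\<^sub>R \<phi>' r) = \<phi> t - \<phi> s"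
    using le
    by (intro integral_FTC_atLeastAtMost has_vector_derivative_within_subset[OF deriv]
        continuous_on_subset[OF cont]) auto
  then have "ennreal \<bar>\<phi> s - \<phi> t\<bar> = ennreal (norm (\<integral>r. indicator {s..t} r *\<^sub>R \<phi>' r \<partial>lborel))"
    by (simp add: abs_minus_commute)
  also have "\<dots> \<le> (\<integral>\<^sup>+r. norm (indicator {s..t} r *\<^sub>R \<phi>' r) \<partial>lborel)"
    using int unfolding set_integrable_def by (rule integral_norm_bound_ennreal)
  also have "\<dots> \<le> (\<integral>\<^sup>+r. ennreal \<bar>\<phi>' r\<bar> * indicator {\<alpha>..\<beta>} r \<partial>lborel)"
    using le by (intro nn_integral_mono) (auto simp: indicator_def)
  finally show ?case .
qed (simp add: abs_minus_commute)

text \<open>Rectangles determine a product measure, and the preimage of a rectangle under merging is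
  a product of two rectangles. \<open>J\<close> and \<open>K\<close> may overlap because the
  applications merge points of D_u and D, or of D and D_v, with some coordinates discarded.\<close>

lemma (in product_prob_space) distr_PiM_merge:
  assumes "finite J" "finite K" "S \<subseteq> I" "S \<subseteq> J" "I - S \<subseteq> K" "finite I"
  shows "merge S (I - S) \<in> measurable (PiM J M \<Otimes>\<^sub>M PiM K M) (PiM I M)"
    and "distr (PiM J M \<Otimes>\<^sub>M PiM K M) (PiM I M) (merge S (I - S)) = PiM I M"
proof -
  interpret J: finite_product_prob_space M J by standard fact
  interpret K: finite_product_prob_space M K by standard fact
  show meas: "merge S (I - S) \<in> measurable (PiM J M \<Otimes>\<^sub>M PiM K M) (PiM I M)"
  proof (rule measurable_PiM_single')
    fix i assume "i \<in> I"
    then show "(\<lambda>\<omega>. merge S (I - S) \<omega> i) \<in> measurable (PiM J M \<Otimes>\<^sub>M PiM K M) (M i)"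
      using assms by (cases "i \<in> S") (auto simp: merge_def split_beta
          intro!: measurable_component_singleton[THEN measurable_compose[OF measurable_fst]]
            measurable_component_singleton[THEN measurable_compose[OF measurable_snd]])
  next
    show "merge S (I - S) \<in> space (PiM J M \<Otimes>\<^sub>M PiM K M) \<rightarrow> (\<Pi>\<^sub>E i\<in>I. space (M i))"
      using assms by (auto simp: merge_def space_pair_measure space_PiM PiE_def Pi_def extensional_def)
  qed
  show "distr (PiM J M \<Otimes>\<^sub>M PiM K M) (PiM I M) (merge S (I - S)) = PiM I M"
  proof (rule PiM_eqI)
    fix A assume A: "\<And>i. i \<in> I \<Longrightarrow> A i \<in> sets (M i)"
    \<comment> \<open>\<open>B\<close> and \<open>C\<close> constrain only the coordinates that
      survive the merge. All other sides are full spaces of mass one and drop out of the products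
      below.\<close>
    define B where "B i = (if i \<in> S then A i else space (M i))" for i
    define C where "C i = (if i \<in> I - S then A i else space (M i))" for i
    have B: "B i \<in> sets (M i)" and C: "C i \<in> sets (M i)" for i
      using A assms by (auto simp: B_def C_def)
    have "merge S (I - S) -` Pi\<^sub>E I A \<inter> space (PiM J M \<Otimes>\<^sub>M PiM K M) = Pi\<^sub>E J B \<times> Pi\<^sub>E K C"
      using assms A[THEN sets.sets_into_space]
      by (auto simp: space_PiM space_pair_measure merge_def B_def C_def PiE_iff extensional_def
          split: if_splits; blast)
    then have "emeasure (distr (PiM J M \<Otimes>\<^sub>M PiM K M) (PiM I M) (merge S (I - S))) (Pi\<^sub>E I A)
        = emeasure (PiM J M) (Pi\<^sub>E J B) * emeasure (PiM K M) (Pi\<^sub>E K C)"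
      using assms A B C
      by (subst emeasure_distr[OF meas]) (auto intro!: sets_PiM_I_finite K.emeasure_pair_measure_Times)
    also have "\<dots> = (\<Prod>i\<in>J. emeasure (M i) (B i)) * (\<Prod>i\<in>K. emeasure (M i) (C i))"
      using B C assms by (simp add: emeasure_PiM)
    also have "(\<Prod>i\<in>J. emeasure (M i) (B i)) = (\<Prod>i\<in>S. emeasure (M i) (A i))"
      using assms by (intro prod.mono_neutral_cong_right) (auto simp: B_def M.emeasure_space_1)
    also have "(\<Prod>i\<in>K. emeasure (M i) (C i)) = (\<Prod>i\<in>I - S. emeasure (M i) (A i))"
      using assms by (intro prod.mono_neutral_cong_right) (auto simp: C_def M.emeasure_space_1)
    also have "(\<Prod>i\<in>S. emeasure (M i) (A i)) * (\<Prod>i\<in>I - S. emeasure (M i) (A i))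
        = (\<Prod>i\<in>I. emeasure (M i) (A i))"
      using assms by (simp add: prod.subset_diff[of S I] mult.commute)
    finally show "emeasure (distr (PiM J M \<Otimes>\<^sub>M PiM K M) (PiM I M) (merge S (I - S))) (Pi\<^sub>E I A)
        = (\<Prod>i\<in>I. emeasure (M i) (A i))" .
  qed (use assms in auto)
qed

lemma (in product_prob_space) nn_integral_PiM_merge:
  assumes "finite J" "finite K" "S \<subseteq> I" "S \<subseteq> J" "I - S \<subseteq> K" "finite I"
    and h: "h \<in> borel_measurable (PiM I M)"
  shows "(\<integral>\<^sup>+x. \<integral>\<^sup>+y. h (merge S (I - S) (x, y)) \<partial>PiM K M \<partial>PiM J M) = (\<integral>\<^sup>+z. h z \<partial>PiM I M)"
proof -
  interpret K: finite_product_prob_space M K by standard fact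
  note merge = distr_PiM_merge[OF assms(1-6)]
  have "(\<integral>\<^sup>+x. \<integral>\<^sup>+y. h (merge S (I - S) (x, y)) \<partial>PiM K M \<partial>PiM J M)
      = (\<integral>\<^sup>+p. h (merge S (I - S) p) \<partial>(PiM J M \<Otimes>\<^sub>M PiM K M))"
    by (rule K.nn_integral_fst) (rule measurable_compose[OF merge(1) h])
  also have "\<dots> = (\<integral>\<^sup>+z. h z \<partial>distr (PiM J M \<Otimes>\<^sub>M PiM K M) (PiM I M) (merge S (I - S)))"
    using h by (subst nn_integral_distr[OF merge(1)]) simp_all
  finally show ?thesis by (simp add: merge(2))
qed

section \<open>The box and its uniform product measure\<close>

locale anova_box =
  fixes d :: nat and a b :: point
  assumes less: "i \<in> {1..d} \<Longrightarrow> a i < b i"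
begin

abbreviation "I \<equiv> {1..d}"
abbreviation "D \<equiv> subbox a b I"

text \<open>The value for \<open>i \<notin> I\<close> is irrelevant, but a product measure needs a probability measure
  at every index.\<close>

definition side :: "nat \<Rightarrow> real measure" where
  "side i = uniform_measure lborel (if a i < b i then {a i..b i} else {0..1})"

lemma sets_side [simp, measurable_cong]: "sets (side i) = sets borel"
  by (simp add: side_def)

lemma space_side [simp]: "space (side i) = UNIV"
  using sets_eq_imp_space_eq[OF sets_side] by simp

lemma prob_space_side: "prob_space (side i)"
  by (auto simp: side_def intro!: prob_space_uniform_measure)

sublocale sides: product_prob_space side I
proof -
  interpret prob_space "side i" for i by (rule prob_space_side)
  show "product_prob_space side" by unfold_locales
qed

lemma prob_space_PiM_side: "finite w \<Longrightarrow> prob_space (PiM w side)"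
proof -
  assume "finite w"
  then interpret finite_product_prob_space side w by unfold_locales
  show ?thesis by (rule prob_space_axioms)
qed

lemma sets_PiM_side: "sets (PiM w side) = sets (PiM w (\<lambda>_. borel))"
  by (intro sets_PiM_cong) auto

lemma space_PiM_side: "space (PiM w side) = extensional w"
  by (auto simp: space_PiM PiE_def)

lemma D_subset_space: "x \<in> D \<Longrightarrow> x \<in> space (PiM I side)"
  by (auto simp: space_PiM_side subbox_def PiE_def)

lemma D_upd: "x \<in> D \<Longrightarrow> j \<in> I \<Longrightarrow> t \<in> {a j..b j} \<Longrightarrow> x(j := t) \<in> D"
  by (auto simp: subbox_def PiE_iff extensional_def)

lemma D_nth: "x \<in> D \<Longrightarrow> j \<in> I \<Longrightarrow> x j \<in> {a j..b j}"
  by (auto simp: subbox_def PiE_iff)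

lemma emeasure_side:
  assumes "i \<in> I" "A \<in> sets borel"
  shows "emeasure (side i) A = emeasure lborel ({a i..b i} \<inter> A) / ennreal (b i - a i)"
  using less[OF assms(1)] assms(2) by (simp add: side_def)

text \<open>The exchange rate between an integral along a side and an average over it. Its factor is
  the source of the ordinary, not normalized, volume of D_v in the estimates.\<close>

lemma nn_integral_side:
  assumes "i \<in> I" "h \<in> borel_measurable borel"
  shows "(\<integral>\<^sup>+t. h t * indicator {a i..b i} t \<partial>lborel) = ennreal (b i - a i) * (\<integral>\<^sup>+t. h t \<partial>side i)"
proof -
  have "(\<integral>\<^sup>+t. h t \<partial>side i) = (\<integral>\<^sup>+t. h t * indicator {a i..b i} t \<partial>lborel) / ennreal (b i - a i)"
    using less[OF assms(1)] assms(2) by (simp add: side_def nn_integral_uniform_measure)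
  then have "ennreal (b i - a i) * (\<integral>\<^sup>+t. h t \<partial>side i)
      = (\<integral>\<^sup>+t. h t * indicator {a i..b i} t \<partial>lborel) * ennreal (b i - a i) / ennreal (b i - a i)"
    by (simp add: ennreal_times_divide mult.commute)
  also have "\<dots> = (\<integral>\<^sup>+t. h t * indicator {a i..b i} t \<partial>lborel)"
    using less[OF assms(1)] by (intro ennreal_mult_divide_eq) auto
  finally show ?thesis ..
qed

lemma subbox_in_sets: "finite w \<Longrightarrow> subbox a b w \<in> sets (lebesgue_on_coords w)"
  unfolding lebesgue_on_coords_def subbox_def by (intro sets_PiM_I_finite) auto

lemma emeasure_subbox:
  assumes "w \<subseteq> I"
  shows "emeasure (lebesgue_on_coords w) (subbox a b w) = ennreal (\<Prod>i\<in>w. b i - a i)"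
    and "0 < (\<Prod>i\<in>w. b i - a i)"
proof -
  have w: "finite w" using assms finite_subset by blast
  have lt: "a i < b i" if "i \<in> w" for i using less assms that by blast
  show "0 < (\<Prod>i\<in>w. b i - a i)" using lt by (intro prod_pos) auto
  have "emeasure (lebesgue_on_coords w) (subbox a b w) = (\<Prod>i\<in>w. ennreal (b i - a i))"
    using lt w by (intro emeasure_lebesgue_on_coords_subbox) (auto intro: less_imp_le)
  then show "emeasure (lebesgue_on_coords w) (subbox a b w) = ennreal (\<Prod>i\<in>w. b i - a i)"
    using lt by (subst (asm) prod_ennreal) (auto intro: less_imp_le)
qed

text \<open>Normalizing the product or each factor gives the same measure, since both assign to a
  rectangle the product of the relative side lengths. This makes Fubini and independence of the
  coordinates available.\<close>

lemma normalized_lebesgue_eq_PiM: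
  assumes "w \<subseteq> I"
  shows "normalized_lebesgue a b w = PiM w side"
proof (rule sides.PiM_eqI)
  show w: "finite w" using assms finite_subset by blast
  show "sets (normalized_lebesgue a b w) = sets (PiM w side)"
    by (simp add: normalized_lebesgue_def lebesgue_on_coords_def sets_PiM_side cong: sets_PiM_cong)
  fix A assume "\<And>i. i \<in> w \<Longrightarrow> A i \<in> sets (side i)"
  then have A: "\<And>i. i \<in> w \<Longrightarrow> A i \<in> sets borel" by simp
  interpret L: product_sigma_finite "\<lambda>_. lborel :: real measure" by standard
  \<comment> \<open>The lengths are finite, so the quotient of products is rearranged in the reals
    and then carried back to \<open>ennreal\<close>.\<close>
  define m where "m i = measure lborel ({a i..b i} \<inter> A i)" for i
  have m: "emeasure lborel ({a i..b i} \<inter> A i) = ennreal (m i)" for i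
  proof -
    have "emeasure lborel ({a i..b i} \<inter> A i) \<le> emeasure lborel {a i..b i}"
      by (intro emeasure_mono) auto
    also have "\<dots> < \<infinity>" by (simp add: emeasure_lborel_Icc_eq)
    finally show ?thesis
      unfolding m_def by (intro emeasure_eq_ennreal_measure) auto
  qed
  have "emeasure (normalized_lebesgue a b w) (Pi\<^sub>E w A)
      = emeasure (lebesgue_on_coords w) (subbox a b w \<inter> Pi\<^sub>E w A)
        / emeasure (lebesgue_on_coords w) (subbox a b w)"
    unfolding normalized_lebesgue_def
    by (rule emeasure_uniform_measure[OF subbox_in_sets[OF w]])
      (use A w in \<open>auto simp: lebesgue_on_coords_def intro!: sets_PiM_I_finite\<close>)
  also have "subbox a b w \<inter> Pi\<^sub>E w A = (\<Pi>\<^sub>E i\<in>w. {a i..b i} \<inter> A i)"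
    by (simp add: subbox_def PiE_Int)
  also have "emeasure (lebesgue_on_coords w) \<dots> = (\<Prod>i\<in>w. ennreal (m i))"
    unfolding lebesgue_on_coords_def using A w by (subst L.emeasure_PiM) (auto simp: m)
  also have "\<dots> = ennreal (\<Prod>i\<in>w. m i)"
    by (intro prod_ennreal) (simp add: m_def)
  also have "\<dots> / emeasure (lebesgue_on_coords w) (subbox a b w)
      = ennreal (\<Prod>i\<in>w. m i / (b i - a i))"
    using emeasure_subbox[OF assms]
    by (simp add: divide_ennreal prod_nonneg m_def prod_dividef)
  also have "\<dots> = (\<Prod>i\<in>w. ennreal (m i / (b i - a i)))"
    using less assms by (intro prod_ennreal[symmetric] divide_nonneg_pos) (auto simp: m_def)
  also have "\<dots> = (\<Prod>i\<in>w. emeasure (side i) (A i))"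
    using less assms A by (intro prod.cong) (auto simp: emeasure_side m divide_ennreal m_def)
  finally show "emeasure (normalized_lebesgue a b w) (Pi\<^sub>E w A) = (\<Prod>i\<in>w. emeasure (side i) (A i))" .
qed

lemma AE_PiM_side:
  assumes "w \<subseteq> I"
  shows "AE x in PiM w side. x \<in> subbox a b w"
proof -
  have "finite w" using assms finite_subset by blast
  then show ?thesis
    unfolding normalized_lebesgue_eq_PiM[OF assms, symmetric] normalized_lebesgue_def
    by (intro AE_uniform_measureI subbox_in_sets) auto
qed

section \<open>Continuity and measurability on the box\<close>

text \<open>Replacing \<open>g\<close> by zero outside \<open>D\<close> makes it globally measurable.\<close>

definition cutoff :: "(point \<Rightarrow> real) \<Rightarrow> point \<Rightarrow> real" where
  "cutoff g x = (if x \<in> D then g x else 0)"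

lemma D_measurable [measurable]: "D \<in> sets (PiM I side)"
  using subbox_in_sets[of I] by (simp add: lebesgue_on_coords_def sets_PiM_side cong: sets_PiM_cong)

text \<open>Continuity is known on D only. Composing g with the coordinatewise retraction
  \<open>clamp\<close> onto D gives a globally continuous function, and the cutoff is this function
  times the indicator of D.\<close>

lemma measurable_cutoff:
  assumes "continuous_on D g"
  shows "cutoff g \<in> borel_measurable (PiM I side)"
proof -
  define clamp :: "point \<Rightarrow> point" where
    "clamp z i = (if i \<in> I then max (a i) (min (b i) (z i)) else undefined)" for z i
  have clamp_D: "clamp z \<in> D" for z
    using less by (auto simp: clamp_def subbox_def PiE_iff extensional_def max_def min_def less_imp_le)
  have clamp_id: "clamp z = z" if "z \<in> D" for z
    using that by (auto simp: clamp_def subbox_def PiE_iff extensional_def fun_eq_iff)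
  have "continuous_on UNIV clamp"
  proof (rule continuous_on_coordinatewise_then_product)
    fix i
    have "continuous_on UNIV (\<lambda>z::point. z i)"
      by (rule continuous_on_product_coordinates)
    then show "continuous_on UNIV (\<lambda>z. clamp z i)"
      by (cases "i \<in> I") (auto simp: clamp_def intro!: continuous_intros)
  qed
  then have "continuous_on UNIV (\<lambda>z. g (clamp z))"
    by (rule continuous_on_compose2[OF assms]) (use clamp_D in auto)
  then have "(\<lambda>z. g (clamp z)) \<in> borel_measurable borel"
    by (rule borel_measurable_continuous_onI)
  \<comment> \<open>The Borel sets of the function space are generated by the coordinates, and those
    outside \<open>I\<close> are constantly \<open>undefined\<close> on extensional points.\<close>
  moreover have "(\<lambda>z. z) \<in> measurable (PiM I side) borel"
    unfolding measurable_cong_sets[OF refl sets_PiM_equal_borel[symmetric]]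
  proof (rule measurable_PiM_single')
    fix i :: nat
    show "(\<lambda>z. z i) \<in> borel_measurable (PiM I side)"
    proof (cases "i \<in> I")
      case True
      then show ?thesis by measurable
    next
      case False
      then have "(\<lambda>z. z i) \<in> borel_measurable (PiM I side) \<longleftrightarrow>
          (\<lambda>z. undefined :: real) \<in> borel_measurable (PiM I side)"
        by (intro measurable_cong) (auto simp: space_PiM_side extensional_def)
      then show ?thesis by simp
    qed
  qed simp
  ultimately have "(\<lambda>z. g (clamp z)) \<in> borel_measurable (PiM I side)"
    by (rule measurable_compose[rotated])
  then have "(\<lambda>z. indicator D z * g (clamp z)) \<in> borel_measurable (PiM I side)"
    by measurable
  moreover have "cutoff g = (\<lambda>z. indicator D z * g (clamp z))"
    by (auto simp: cutoff_def fun_eq_iff clamp_id)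
  ultimately show ?thesis by simp
qed

lemma continuous_upd:
  assumes "continuous_on D g" "j \<in> I"
  shows "t \<in> {a j..b j} \<Longrightarrow> continuous_on D (\<lambda>x. g (x(j := t)))"
    and "x \<in> D \<Longrightarrow> continuous_on {a j..b j} (\<lambda>t. g (x(j := t)))"
proof -
  assume t: "t \<in> {a j..b j}"
  have "continuous_on D (\<lambda>x. x(j := t))"
  proof (rule continuous_on_coordinatewise_then_product)
    fix i
    have "continuous_on D (\<lambda>z::point. z i)"
      by (rule continuous_on_subset[OF continuous_on_product_coordinates]) simp
    then show "continuous_on D (\<lambda>x. (x(j := t)) i)"
      by (cases "i = j") auto
  qed
  then show "continuous_on D (\<lambda>x. g (x(j := t)))"
    by (rule continuous_on_compose2[OF assms(1)]) (use t assms(2) D_upd in auto)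
next
  assume x: "x \<in> D"
  have "continuous_on {a j..b j} (\<lambda>t. x(j := t))"
  proof (rule continuous_on_coordinatewise_then_product)
    fix i
    show "continuous_on {a j..b j} (\<lambda>t. (x(j := t)) i)"
      by (cases "i = j") auto
  qed
  then show "continuous_on {a j..b j} (\<lambda>t. g (x(j := t)))"
    by (rule continuous_on_compose2[OF assms(1)]) (use x assms(2) D_upd in auto)
qed

section \<open>Derivatives of anchored products\<close>

lemma continuous_foldr_anchored_factor:
  assumes "continuous_on D g" "set js \<subseteq> I" "y \<in> D"
  shows "continuous_on D (foldr (anchored_factor y u) js g)"
  using assms(2)
proof (induction js)
  case (Cons j js)
  then have c: "continuous_on D (foldr (anchored_factor y u) js g)" and j: "j \<in> I" by auto
  have "continuous_on D (\<lambda>x. foldr (anchored_factor y u) js g (x(j := y j)))"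
    by (rule continuous_upd(1)[OF c j]) (use assms(3) j D_nth in blast)
  then show ?case
    using c by (cases "j \<in> u") (simp_all add: anchored_factor_apply[abs_def] continuous_on_diff)
qed (use assms(1) in simp)

text \<open>Differentiation in the variable j passes through the factors of the other directions,
  because these combine values at points updated in coordinates different from j.\<close>

lemma foldr_anchored_factor_deriv:
  assumes diff: "\<And>z. z \<in> D \<Longrightarrow> (\<lambda>t. f (z(j := t))) differentiable (at (z j) within {a j..b j})"
    and "j \<in> I" "j \<notin> set js" "set js \<subseteq> I" "y \<in> D" "x \<in> D" "r \<in> {a j..b j}"
  shows "((\<lambda>t. foldr (anchored_factor y u) js f (x(j := t))) has_vector_derivative
      foldr (anchored_factor y u) js (partial_deriv a b j f) (x(j := r))) (at r within {a j..b j})"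
  using assms(3,4,6)
proof (induction js arbitrary: x)
  case Nil
  show ?case
    using vector_derivative_works[THEN iffD1, OF diff[OF D_upd[OF Nil(3) assms(2,7)]]]
    by (simp add: partial_deriv_def fun_upd_same del: fun_upd_apply)
next
  case (Cons i js)
  then have i: "i \<in> I" "i \<noteq> j" "x(i := y i) \<in> D"
    using assms(5) D_upd D_nth by auto
  have "((\<lambda>t. foldr (anchored_factor y u) js f (x(j := t, i := y i))) has_vector_derivative
      foldr (anchored_factor y u) js (partial_deriv a b j f) (x(j := r, i := y i)))
        (at r within {a j..b j})"
    using Cons.IH[OF _ _ i(3)] Cons.prems i by (simp add: fun_upd_twist[OF i(2)] del: fun_upd_apply)
  moreover have "((\<lambda>t. foldr (anchored_factor y u) js f (x(j := t))) has_vector_derivative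
      foldr (anchored_factor y u) js (partial_deriv a b j f) (x(j := r))) (at r within {a j..b j})"
    by (rule Cons.IH) (use Cons.prems in auto)
  ultimately show ?case
    unfolding foldr_anchored_factor_Cons
    by (cases "i \<in> u") (simp_all del: fun_upd_apply add: has_vector_derivative_diff)
qed

text \<open>The induction removes the derivative applied first, which is the one that
  \<open>C_k\<close> unfolds.\<close>

lemma continuous_foldr_partial_deriv:
  assumes "C_k (length js) d a b f" "set js \<subseteq> I"
  shows "continuous_on D (foldr (partial_deriv a b) js f)"
  using assms
proof (induction js arbitrary: f rule: rev_induct)
  case (snoc j js)
  then show ?case by simp
qed simp

lemma continuous_mixed_deriv:
  assumes "C_k (card v) d a b f" "v \<subseteq> I"
  shows "continuous_on D (mixed_deriv a b v f)"
proof -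
  have "finite v" using assms finite_subset by blast
  then show ?thesis
    unfolding mixed_deriv_def compose_over_def
    using assms by (intro continuous_foldr_partial_deriv) auto
qed

section \<open>Averages over part of the coordinates\<close>

text \<open>Up to the volume of D_v, this is what integrating back along the directions of v leaves
  over. It takes a full point z, whose v-coordinates are overwritten, so that it can be evaluated at
  any mixed point.\<close>

definition average :: "nat set \<Rightarrow> (point \<Rightarrow> real) \<Rightarrow> point \<Rightarrow> ennreal" where
  "average v g z = (\<integral>\<^sup>+t. ennreal \<bar>cutoff g (merge (I - v) v (z, t))\<bar> \<partial>PiM v side)"

lemma measurable_merge_point:
  assumes "v \<subseteq> I"
  shows "merge (I - v) v \<in> measurable (PiM I side \<Otimes>\<^sub>M PiM v side) (PiM I side)"
proof -
  have "I - (I - v) = v" "finite v" using assms finite_subset by auto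
  then show ?thesis
    using sides.distr_PiM_merge(1)[of I v "I - v"] by auto
qed

lemma measurable_cutoff_merge:
  assumes "continuous_on D g" "v \<subseteq> I"
  shows "(\<lambda>p. ennreal \<bar>cutoff g (merge (I - v) v p)\<bar>) \<in> borel_measurable (PiM I side \<Otimes>\<^sub>M PiM v side)"
  using measurable_compose[OF measurable_merge_point[OF assms(2)] measurable_cutoff[OF assms(1)]]
  by measurable

lemma measurable_average:
  assumes "continuous_on D g" "v \<subseteq> I"
  shows "average v g \<in> borel_measurable (PiM I side)"
proof -
  interpret prob_space "PiM v side"
    using assms finite_subset by (intro prob_space_PiM_side) blast
  show ?thesis
    unfolding average_def[abs_def]
    by (rule borel_measurable_nn_integral_fst[OF measurable_cutoff_merge[OF assms]])
qed

lemma average_empty: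
  assumes "x \<in> D"
  shows "average {} g x = ennreal \<bar>g x\<bar>"
proof -
  have "merge I {} (x, t) = x" for t
    using assms by (auto simp: merge_def subbox_def PiE_iff extensional_def fun_eq_iff)
  then show ?thesis
    using assms by (simp add: average_def cutoff_def prob_space.emeasure_space_1 prob_space_PiM_side)
qed

lemma average_insert:
  assumes g: "continuous_on D g" and v: "v \<subseteq> I" and j: "j \<in> I" "j \<notin> v" and x: "x \<in> D"
  shows "(\<integral>\<^sup>+r. average v g (x(j := r)) \<partial>side j) = average (insert j v) g x"
proof -
  have fin: "finite v" using v finite_subset by blast
  have "(\<lambda>t. (x, t)) \<in> measurable (PiM (insert j v) side) (PiM I side \<Otimes>\<^sub>M PiM (insert j v) side)"
    using D_subset_space[OF x] by simp
  then have "(\<lambda>t. ennreal \<bar>cutoff g (merge (I - insert j v) (insert j v) (x, t))\<bar>)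
      \<in> borel_measurable (PiM (insert j v) side)"
    by (rule measurable_compose) (rule measurable_cutoff_merge[OF g]; use v j in auto)
  then have "average (insert j v) g x = (\<integral>\<^sup>+r. \<integral>\<^sup>+t. ennreal
      \<bar>cutoff g (merge (I - insert j v) (insert j v) (x, t(j := r)))\<bar> \<partial>PiM v side \<partial>side j)"
    unfolding average_def by (rule sides.product_nn_integral_insert_rev[OF fin j(2)])
  \<comment> \<open>On the left coordinate j is read from the second point, on the right from the
    first; both carry r there.\<close>
  moreover have "merge (I - insert j v) (insert j v) (x, t(j := r)) = merge (I - v) v (x(j := r), t)"
    for t r
    using j by (auto simp: merge_def fun_eq_iff)
  ultimately show ?thesis
    by (simp add: average_def)
qed

section \<open>Anchored summands bounded by averages of the mixed derivative\<close>

text \<open>Each direction costs one integral along its side. The difference applied first is traded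
  for a derivative, the induction hypothesis is used for that derivative, and the remaining integral
  adds j to the averaged coordinates with a factor \<open>b j - a j\<close>.\<close>

lemma foldr_anchored_factor_le_average:
  assumes "C_k (length js) d a b f" "set js \<subseteq> I" "distinct js" "set js \<subseteq> u" "y \<in> D" "x \<in> D"
  shows "ennreal \<bar>foldr (anchored_factor y u) js f x\<bar>
    \<le> ennreal (\<Prod>i\<in>set js. b i - a i) * average (set js) (foldr (partial_deriv a b) js f) x"
  using assms(1-4,6)
proof (induction js arbitrary: f x rule: rev_induct)
  case Nil
  then show ?case by (simp add: average_empty)
next
  case (snoc j js)
  then have j: "j \<in> I" "j \<notin> set js" "j \<in> u" by auto
  define f' where "f' = partial_deriv a b j f"
  define g where "g = foldr (partial_deriv a b) js f'"
  have f': "C_k (length js) d a b f'" using snoc.prems j by (simp add: f'_def)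
  then have cont': "continuous_on D f'" by (cases "length js") auto
  have g: "continuous_on D g"
    unfolding g_def using f' snoc.prems by (intro continuous_foldr_partial_deriv) auto
  define V where "V = (\<Prod>i\<in>set js. b i - a i)"
  have V: "0 \<le> V"
    unfolding V_def using emeasure_subbox(2)[of "set js"] snoc.prems by simp
  have upd: "x(j := r) \<in> D" if "r \<in> {a j..b j}" for r
    using D_upd[OF snoc.prems(5) j(1) that] .
  have meas: "(\<lambda>r. average (set js) g (x(j := r))) \<in> borel_measurable borel"
  proof (rule measurable_compose[OF _ measurable_average[OF g]])
    show "(\<lambda>r. x(j := r)) \<in> measurable borel (PiM I side)"
      using j D_subset_space[OF snoc.prems(5)]
      by (intro measurable_PiM_single') (auto simp: space_PiM_side extensional_def)
  qed (use snoc.prems in auto)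
  have "ennreal \<bar>foldr (anchored_factor y u) (js @ [j]) f x\<bar>
    = ennreal \<bar>foldr (anchored_factor y u) js f (x(j := x j))
        - foldr (anchored_factor y u) js f (x(j := y j))\<bar>"
    using j by (simp add: foldr_anchored_factor_upd)
  \<comment> \<open>Both terms are values of one function of the j-th variable, whose derivative is
    the same product applied to \<open>f'\<close>.\<close>
  also have "\<dots> \<le> (\<integral>\<^sup>+r. ennreal \<bar>foldr (anchored_factor y u) js f' (x(j := r))\<bar>
      * indicator {a j..b j} r \<partial>lborel)"
  proof (rule increment_le_nn_integral[where \<phi> = "\<lambda>t. foldr (anchored_factor y u) js f (x(j := t))"])
    show "x j \<in> {a j..b j}" by (rule D_nth[OF snoc.prems(5) j(1)])
    show "y j \<in> {a j..b j}" by (rule D_nth[OF assms(5) j(1)])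
    show "((\<lambda>t. foldr (anchored_factor y u) js f (x(j := t))) has_vector_derivative
      foldr (anchored_factor y u) js f' (x(j := r))) (at r within {a j..b j})"
      if "r \<in> {a j..b j}" for r
      unfolding f'_def
      by (rule foldr_anchored_factor_deriv) (use snoc.prems j that assms(5) in auto)
    show "continuous_on {a j..b j} (\<lambda>r. foldr (anchored_factor y u) js f' (x(j := r)))"
      by (rule continuous_upd(2)[OF continuous_foldr_anchored_factor])
        (use cont' snoc.prems j assms(5) in auto)
  qed
  \<comment> \<open>The induction hypothesis for \<open>f'\<close> is applied at each
    \<open>x(j := r)\<close> with r in the side, which stays in D.\<close>
  also have "\<dots> \<le> (\<integral>\<^sup>+r. ennreal V * average (set js) g (x(j := r))
      * indicator {a j..b j} r \<partial>lborel)"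
  proof (rule nn_integral_mono)
    fix r
    show "ennreal \<bar>foldr (anchored_factor y u) js f' (x(j := r))\<bar> * indicator {a j..b j} r
        \<le> ennreal V * average (set js) g (x(j := r)) * indicator {a j..b j} r"
    proof (cases "r \<in> {a j..b j}")
      case True
      then show ?thesis
        using snoc.IH[of f' "x(j := r)"] upd f' snoc.prems
        by (simp add: V_def g_def del: fun_upd_apply)
    qed simp
  qed
  also have "\<dots> = ennreal (b j - a j) * (\<integral>\<^sup>+r. ennreal V * average (set js) g (x(j := r)) \<partial>side j)"
    using meas by (intro nn_integral_side j) measurable
  also have "\<dots> = ennreal (b j - a j) * (ennreal V * (\<integral>\<^sup>+r. average (set js) g (x(j := r)) \<partial>side j))"
    using meas by (subst nn_integral_cmult) (simp_all cong: measurable_cong_sets)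
  also have "\<dots> = ennreal ((b j - a j) * V) * average (insert j (set js)) g x"
    using less[OF j(1)] V snoc.prems j g
    by (subst average_insert) (auto simp: ennreal_mult mult.assoc)
  finally show ?case
    using j by (simp add: g_def f'_def V_def)
qed

text \<open>The three layers are treated in turn: projections put y outside u, the differences in u
  - v expand into terms indexed by w, and those in v become averages. The term of w keeps x on u - w
  and takes y elsewhere.\<close>

lemma summand_anchored_le_averages:
  assumes "C_k (card v) d a b f" "v \<subseteq> u" "u \<subseteq> I" "x \<in> D" "y \<in> D"
  shows "ennreal \<bar>summand_anchored d y u f x\<bar> \<le> (\<Sum>w\<in>Pow (u - v).
    ennreal (\<Prod>i\<in>v. b i - a i)
      * average v (mixed_deriv a b v f) (merge (u - w) (I - (u - w)) (x, y)))"
proof -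
  have fin: "finite u" "finite v"
    using finite_subset[OF assms(3)] finite_subset[OF assms(2)] by auto
  define h where "h = foldr (anchored_factor y u) (sorted_list_of_set v) f"
  define z where "z i = (if i \<in> I - u then y i else x i)" for i
  have "\<bar>summand_anchored d y u f x\<bar>
      = \<bar>foldr (anchored_factor y u) (sorted_list_of_set (u - v)) h z\<bar>"
    unfolding summand_anchored_eq_foldr[OF assms(2) fin(1)] h_def z_def
    by (subst foldr_anchored_proj) auto
  also have "\<dots> \<le> (\<Sum>w\<in>Pow (u - v). \<bar>h (\<lambda>i. if i \<in> w then y i else z i)\<bar>)"
    using foldr_anchored_diff_le[of "sorted_list_of_set (u - v)" u y h z] fin by auto
  \<comment> \<open>Outside \<open>I\<close> both points are \<open>undefined\<close>, since x is
    extensional.\<close>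
  also have "\<dots> = (\<Sum>w\<in>Pow (u - v). \<bar>h (merge (u - w) (I - (u - w)) (x, y))\<bar>)"
  proof (intro sum.cong refl arg_cong[of _ _ "\<lambda>z. \<bar>h z\<bar>"] ext)
    fix w i assume "w \<in> Pow (u - v)"
    then show "(if i \<in> w then y i else z i) = merge (u - w) (I - (u - w)) (x, y) i"
      using assms(3,4) by (auto simp: z_def merge_def subbox_def PiE_iff extensional_def)
  qed
  finally have "ennreal \<bar>summand_anchored d y u f x\<bar>
      \<le> ennreal (\<Sum>w\<in>Pow (u - v). \<bar>h (merge (u - w) (I - (u - w)) (x, y))\<bar>)"
    by (rule ennreal_leI)
  also have "\<dots> = (\<Sum>w\<in>Pow (u - v). ennreal \<bar>h (merge (u - w) (I - (u - w)) (x, y))\<bar>)"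
    by simp
  also have "\<dots> \<le> (\<Sum>w\<in>Pow (u - v). ennreal (\<Prod>i\<in>v. b i - a i)
      * average v (mixed_deriv a b v f) (merge (u - w) (I - (u - w)) (x, y)))"
  proof (rule sum_mono)
    fix w assume "w \<in> Pow (u - v)"
    have "merge (u - w) (I - (u - w)) (x, y) \<in> D"
      using assms(3-5) by (auto simp: merge_def subbox_def PiE_iff extensional_def)
    then show "ennreal \<bar>h (merge (u - w) (I - (u - w)) (x, y))\<bar>
      \<le> ennreal (\<Prod>i\<in>v. b i - a i)
        * average v (mixed_deriv a b v f) (merge (u - w) (I - (u - w)) (x, y))"
      using foldr_anchored_factor_le_average[of "sorted_list_of_set v" f u y] assms fin
      by (auto simp: h_def mixed_deriv_def compose_over_def)
  qed
  finally show ?thesis .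
qed

section \<open>ANOVA summands as means of anchored summands\<close>

lemma measurable_upd_side:
  assumes "x \<in> space (PiM I side)" "j \<in> I"
  shows "(\<lambda>t. x(j := t)) \<in> measurable (side j) (PiM I side)"
  using assms by (intro measurable_PiM_single') (auto simp: space_PiM_side extensional_def)

text \<open>Joint measurability in anchor and point, as Fubini requires. Leaving \<open>K\<close>
  free allows anchors that carry only some of the coordinates, as they occur in the induction
  below.\<close>

lemma measurable_foldr_anchored_factor:
  assumes "g \<in> borel_measurable (PiM I side)" "set js \<subseteq> I" "set js \<subseteq> K"
  shows "(\<lambda>p. foldr (anchored_factor (fst p) u) js g (snd p))
    \<in> borel_measurable (PiM K side \<Otimes>\<^sub>M PiM I side)"
  using assms(2,3)
proof (induction js)
  case Nil
  show ?case using measurable_compose[OF measurable_snd assms(1)] by simp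
next
  case (Cons j js)
  let ?N = "PiM K side \<Otimes>\<^sub>M PiM I side"
  have IH: "(\<lambda>p. foldr (anchored_factor (fst p) u) js g (snd p)) \<in> borel_measurable ?N"
    using Cons by simp
  have "(\<lambda>p. (snd p)(j := fst p j)) \<in> measurable ?N (PiM I side)"
  proof (rule measurable_fun_upd[where J = I])
    show "(\<lambda>p. fst p j) \<in> measurable ?N (side j)"
      using Cons.prems by (intro measurable_compose[OF measurable_fst measurable_component_singleton]) auto
  qed (use Cons.prems in auto)
  then have "(\<lambda>p. (fst p, (snd p)(j := fst p j))) \<in> measurable ?N ?N"
    by (rule measurable_Pair[OF measurable_fst])
  from measurable_compose[OF this IH]
  have "(\<lambda>p. foldr (anchored_factor (fst p) u) js g ((snd p)(j := fst p j))) \<in> borel_measurable ?N"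
    by (simp del: fun_upd_apply)
  then show ?case
    unfolding foldr_anchored_factor_Cons using IH by (cases "j \<in> u") simp_all
qed

text \<open>Every factor at most doubles a bound. The result is uniform in the anchor and hence
  gives integrability over a probability space.\<close>

lemma foldr_anchored_factor_bounded:
  assumes "\<And>z. \<bar>g z\<bar> \<le> B"
  shows "\<bar>foldr (anchored_factor y u) js g x\<bar> \<le> 2 ^ length js * B"
proof (induction js arbitrary: x)
  case (Cons j js)
  have "0 \<le> 2 ^ length js * B" using Cons[of x] by linarith
  then show ?case
    unfolding foldr_anchored_factor_Cons using Cons[of x] Cons[of "x(j := y j)"]
    by (auto simp del: fun_upd_apply)
qed (use assms in simp)

lemma foldr_anchored_factor_cong:
  assumes "\<And>i. i \<in> set js \<Longrightarrow> y i = y' i"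
  shows "foldr (anchored_factor y u) js g = foldr (anchored_factor y' u) js g"
  using assms by (intro foldr_cong) (auto simp: anchored_factor_apply fun_eq_iff)

lemma proj_anova_eq_integral:
  assumes "j \<in> I" and [measurable]: "(\<lambda>t. g (x(j := t))) \<in> borel_measurable borel"
  shows "proj_anova a b j g x = (\<integral>t. g (x(j := t)) \<partial>side j)"
proof -
  have side: "side j = density lborel (\<lambda>t. ennreal (indicator {a j..b j} t / (b j - a j)))"
    using less[OF assms(1)]
    by (auto simp: side_def uniform_measure_def divide_ennreal[symmetric] ennreal_indicator
        intro!: density_cong)
  show ?thesis
    unfolding side proj_anova_def set_lebesgue_integral_def using less[OF assms(1)]
    by (subst integral_density) (auto simp: mult.assoc divide_simps intro!: Bochner_Integration.integral_cong)
qed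

text \<open>An ANOVA projection is the mean of the anchored projection over its anchor coordinate,
  and the identity is its own mean because the side has mass one. Linearity and Fubini extend this
  to products with independent anchor coordinates.\<close>

lemma foldr_anova_factor_eq_integral:
  assumes g: "g \<in> borel_measurable (PiM I side)" and B: "\<And>z. \<bar>g z\<bar> \<le> B"
    and "distinct js" "set js \<subseteq> I" "x \<in> space (PiM I side)"
  shows "foldr (summand_factor (proj_anova a b) u) js g x
    = (\<integral>y. foldr (anchored_factor y u) js g x \<partial>PiM (set js) side)"
  using assms(3-5)
proof (induction js arbitrary: x)
  case Nil
  then show ?case
    by (simp add: prob_space.prob_space prob_space_PiM_side)
next
  case (Cons j js)
  define K where "K = set js"
  have K: "finite K" "K \<subseteq> I" "j \<notin> K" "j \<in> I" using Cons.prems by (auto simp: K_def)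
  define h where "h y z = foldr (anchored_factor y u) js g z" for y z
  \<comment> \<open>Coordinate j of the anchor does not enter the remaining factors, so it can be
    integrated separately.\<close>
  have h_upd: "h (y(j := t)) = h y" for y t
    unfolding h_def using K(3)
    by (intro ext fun_cong[OF foldr_anchored_factor_cong]) (auto simp: K_def)
  have h_bd: "norm (h y z) \<le> 2 ^ length js * B" for y z
    using foldr_anchored_factor_bounded[where g = g, OF B] by (simp add: h_def)
  interpret PK: prob_space "PiM K side" by (rule prob_space_PiM_side[OF K(1)])
  interpret PjK: prob_space "PiM (insert j K) side" using K by (intro prob_space_PiM_side) auto
  interpret pair_prob_space "PiM K side" "side j" ..
  have h_meas: "(\<lambda>p. h (fst p) (snd p)) \<in> borel_measurable (PiM K side \<Otimes>\<^sub>M PiM I side)"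
    unfolding h_def using Cons.prems K
    by (intro measurable_foldr_anchored_factor[OF g]) (auto simp: K_def)
  have x: "x(j := t) \<in> space (PiM I side)" for t
    using Cons.prems K by (auto simp: space_PiM_side extensional_def)
  have "(\<lambda>p. (fst p, x(j := snd p))) \<in> measurable (PiM K side \<Otimes>\<^sub>M side j) (PiM K side \<Otimes>\<^sub>M PiM I side)"
    using measurable_upd_side[OF Cons.prems(3) K(4)]
    by (intro measurable_Pair measurable_fst measurable_compose[OF measurable_snd])
  from measurable_compose[OF this h_meas]
  have m2: "(\<lambda>p. h (fst p) (x(j := snd p))) \<in> borel_measurable (PiM K side \<Otimes>\<^sub>M side j)"
    by (simp del: fun_upd_apply)
  have m1: "(\<lambda>y. h y z) \<in> borel_measurable (PiM K side)" if "z \<in> space (PiM I side)" for z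
    using measurable_compose[OF measurable_Pair2'[OF that] h_meas] by simp
  have int1: "integrable (PiM K side) (\<lambda>y. h y z)" if "z \<in> space (PiM I side)" for z
    by (rule PK.integrable_const_bound[OF AE_I2[OF h_bd] m1[OF that]])
  have int2: "integrable (PiM K side \<Otimes>\<^sub>M side j) (\<lambda>p. h (fst p) (x(j := snd p)))"
    by (rule P.integrable_const_bound[OF AE_I2[OF h_bd] m2])
  have IH: "foldr (summand_factor (proj_anova a b) u) js g z = (\<integral>y. h y z \<partial>PiM K side)"
    if "z \<in> space (PiM I side)" for z
    using Cons.IH[OF _ _ that] Cons.prems by (simp add: h_def K_def)
  have "proj_anova a b j (foldr (summand_factor (proj_anova a b) u) js g) x
      = (\<integral>t. foldr (summand_factor (proj_anova a b) u) js g (x(j := t)) \<partial>side j)"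
  proof (rule proj_anova_eq_integral[OF K(4)])
    have "(\<lambda>t. \<integral>y. h y (x(j := t)) \<partial>PiM K side) \<in> borel_measurable (side j)"
      using measurable_pair_swap[OF m2]
      by (intro PK.borel_measurable_lebesgue_integral) (simp add: split_beta' del: fun_upd_apply)
    then show "(\<lambda>t. foldr (summand_factor (proj_anova a b) u) js g (x(j := t))) \<in> borel_measurable borel"
      by (simp add: IH[OF x] cong: measurable_cong_sets del: fun_upd_apply)
  qed
  also have "\<dots> = (\<integral>t. \<integral>y. h y (x(j := t)) \<partial>PiM K side \<partial>side j)"
    by (simp add: IH[OF x] del: fun_upd_apply)
  \<comment> \<open>Fubini exchanges the new anchor coordinate t with the earlier ones; boundedness
    of \<open>h\<close> supplies integrability.\<close>
  also have "\<dots> = (\<integral>y. \<integral>t. h y (x(j := t)) \<partial>side j \<partial>PiM K side)"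
    by (rule Fubini_integral) (use int2 in \<open>simp add: split_beta'\<close>)
  finally have proj: "proj_anova a b j (foldr (summand_factor (proj_anova a b) u) js g) x
      = (\<integral>y. \<integral>t. h y (x(j := t)) \<partial>side j \<partial>PiM K side)" .
  have int3: "integrable (PiM K side) (\<lambda>y. \<integral>t. h y (x(j := t)) \<partial>side j)"
    using integrable_fst'[OF int2] by simp
  have int4: "integrable (side j) (\<lambda>t. h y (x(j := t)))" if "y \<in> space (PiM K side)" for y
    by (rule sides.M.integrable_const_bound[OF AE_I2[OF h_bd]])
      (use measurable_compose[OF measurable_Pair1'[OF that] m2] in simp)
  have "(\<integral>y. foldr (anchored_factor y u) (j # js) g x \<partial>PiM (set (j # js)) side)
      = (\<integral>y. foldr (anchored_factor y u) (j # js) g x \<partial>PiM (insert j K) side)"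
    by (simp add: K_def)
  also have "\<dots> = (\<integral>y. \<integral>t. foldr (anchored_factor (y(j := t)) u) (j # js) g x \<partial>side j \<partial>PiM K side)"
  proof (rule sides.product_integral_insert[OF K(1,3)])
    have "(\<lambda>y. foldr (anchored_factor y u) (j # js) g x) \<in> borel_measurable (PiM (insert j K) side)"
      using measurable_compose[OF measurable_Pair2'[OF Cons.prems(3)]
        measurable_foldr_anchored_factor[OF g Cons.prems(2), of "insert j K" u]]
      by (simp add: K_def del: foldr.simps)
    then show "integrable (PiM (insert j K) side) (\<lambda>y. foldr (anchored_factor y u) (j # js) g x)"
      by (rule PjK.integrable_const_bound[where B = "2 ^ length (j # js) * B", rotated])
        (intro AE_I2, simp only: real_norm_def, rule foldr_anchored_factor_bounded[OF B])
  qed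
  also have "\<dots> = (\<integral>y. \<integral>t. (if j \<in> u then h y x - h y (x(j := t)) else h y (x(j := t))) \<partial>side j \<partial>PiM K side)"
    by (simp only: foldr_anchored_factor_Cons h_def[symmetric] h_upd fun_upd_same)
  \<comment> \<open>Both kinds of factor in one formula: a difference has an extra identity term and
    a negative projection.\<close>
  also have "\<dots> = (if j \<in> u then (\<integral>y. h y x \<partial>PiM K side) else 0)
      + (if j \<in> u then -1 else 1) * (\<integral>y. \<integral>t. h y (x(j := t)) \<partial>side j \<partial>PiM K side)"
  proof (cases "j \<in> u")
    case True
    have "(\<integral>y. \<integral>t. h y x - h y (x(j := t)) \<partial>side j \<partial>PiM K side)
        = (\<integral>y. h y x - (\<integral>t. h y (x(j := t)) \<partial>side j) \<partial>PiM K side)"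
    proof (rule Bochner_Integration.integral_cong[OF refl])
      fix y assume y: "y \<in> space (PiM K side)"
      show "(\<integral>t. h y x - h y (x(j := t)) \<partial>side j) = h y x - (\<integral>t. h y (x(j := t)) \<partial>side j)"
        using int4[OF y] sides.M.prob_space by (subst Bochner_Integration.integral_diff) simp_all
    qed
    then show ?thesis
      using True int1[OF Cons.prems(3)] int3 by simp
  qed simp
  also have "\<dots> = foldr (summand_factor (proj_anova a b) u) (j # js) g x"
    using IH[OF Cons.prems(3)] proj by (simp add: summand_factor_def)
  finally show ?case ..
qed

text \<open>The ambient type has all naturals as indices, so D is written as a full product with
  sides \<open>{undefined}\<close> outside \<open>I\<close>, to which Tychonoff applies.\<close>

lemma compact_D: "compact D"
proof -
  define S where "S i = (if i \<in> I then {a i..b i} else {undefined})" for i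
  have "D = Pi\<^sub>E UNIV S"
    by (auto simp: subbox_def S_def PiE_iff extensional_def split: if_splits)
  moreover have "compactin (product_topology (\<lambda>_. euclidean) UNIV) (Pi\<^sub>E UNIV S)"
    by (auto simp: compactin_PiE S_def)
  ultimately show ?thesis
    by (simp add: euclidean_product_topology)
qed

lemma cutoff_bounded:
  assumes "continuous_on D g"
  obtains B where "\<And>z. \<bar>cutoff g z\<bar> \<le> B"
proof -
  have "bounded (g ` D)"
    using compact_continuous_image[OF assms compact_D] by (rule compact_imp_bounded)
  then obtain B where B: "\<And>z. z \<in> D \<Longrightarrow> \<bar>g z\<bar> \<le> B"
    by (auto simp: bounded_iff)
  have "\<bar>cutoff g z\<bar> \<le> max 0 B" for z
    using B[of z] by (auto simp: cutoff_def)
  then show thesis by (rule that)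
qed

text \<open>Starting from a point of D, the averages move each coordinate within its side only, so f
  is read on D alone.\<close>

lemma foldr_anova_factor_cutoff:
  assumes "set js \<subseteq> I" "x \<in> D"
  shows "foldr (summand_factor (proj_anova a b) u) js f x
    = foldr (summand_factor (proj_anova a b) u) js (cutoff f) x"
  using assms
proof (induction js arbitrary: x)
  case (Cons j js)
  have eq: "foldr (summand_factor (proj_anova a b) u) js f (x(j := t))
      = foldr (summand_factor (proj_anova a b) u) js (cutoff f) (x(j := t))" if "t \<in> {a j..b j}" for t
    using Cons.prems that by (intro Cons.IH D_upd) simp_all
  have "proj_anova a b j (foldr (summand_factor (proj_anova a b) u) js f) x
      = proj_anova a b j (foldr (summand_factor (proj_anova a b) u) js (cutoff f)) x"
    unfolding proj_anova_def[of a b j]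
    by (intro arg_cong2[where f = "(*)"] refl set_lebesgue_integral_cong allI impI eq) simp_all
  then show ?case
    unfolding foldr_summand_factor_Cons using Cons by simp
qed (simp add: cutoff_def)

lemma foldr_anchored_factor_cutoff:
  assumes "set js \<subseteq> I" "x \<in> D" "y \<in> D"
  shows "foldr (anchored_factor y u) js f x = foldr (anchored_factor y u) js (cutoff f) x"
  using assms(1,2)
proof (induction js arbitrary: x)
  case (Cons j js)
  then have "x(j := y j) \<in> D"
    using assms(3) D_upd D_nth by auto
  then show ?case
    unfolding foldr_anchored_factor_Cons using Cons by (simp del: fun_upd_apply)
qed (simp add: cutoff_def)

text \<open>The mean formula needs a bounded measurable function and is applied to
  \<open>cutoff f\<close>. The cutoff is then removed for every anchor in D, that is, for almost
  every anchor.\<close>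

lemma summand_anova_le_nn_integral:
  assumes f: "continuous_on D f" and u: "u \<subseteq> I" and x: "x \<in> D"
  shows "ennreal \<bar>summand_anova d a b u f x\<bar>
    \<le> (\<integral>\<^sup>+y. ennreal \<bar>summand_anchored d y u f x\<bar> \<partial>PiM I side)"
proof -
  have fin: "finite u" using u finite_subset by blast
  define js where "js = sorted_list_of_set u @ sorted_list_of_set (I - u)"
  have js: "set js = I" "distinct js"
    using u fin by (auto simp: js_def)
  interpret P: prob_space "PiM I side" by (rule prob_space_PiM_side) simp
  obtain B where B: "\<And>z. \<bar>cutoff f z\<bar> \<le> B"
    using cutoff_bounded[OF f] by blast
  have "(\<lambda>y. foldr (anchored_factor y u) js (cutoff f) x) \<in> borel_measurable (PiM I side)"
    using measurable_compose[OF measurable_Pair2'[OF D_subset_space[OF x]]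
        measurable_foldr_anchored_factor[OF measurable_cutoff[OF f], of js I u]] js(1) by simp
  then have int: "integrable (PiM I side) (\<lambda>y. foldr (anchored_factor y u) js (cutoff f) x)"
    by (rule P.integrable_const_bound[where B = "2 ^ length js * B", rotated])
      (simp add: foldr_anchored_factor_bounded[where g = "cutoff f", OF B])
  have "summand_anova d a b u f x = foldr (summand_factor (proj_anova a b) u) js f x"
    by (simp only: summand_anova_def summand_eq_foldr[OF fin] js_def)
  also have "\<dots> = foldr (summand_factor (proj_anova a b) u) js (cutoff f) x"
    by (rule foldr_anova_factor_cutoff) (use js x in auto)
  also have "\<dots> = (\<integral>y. foldr (anchored_factor y u) js (cutoff f) x \<partial>PiM I side)"
    by (subst foldr_anova_factor_eq_integral[OF measurable_cutoff[OF f] B js(2) _ D_subset_space[OF x]])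
      (simp_all only: js(1) order_refl)
  finally have "summand_anova d a b u f x
      = (\<integral>y. foldr (anchored_factor y u) js (cutoff f) x \<partial>PiM I side)" .
  then have "ennreal \<bar>summand_anova d a b u f x\<bar>
      \<le> (\<integral>\<^sup>+y. ennreal \<bar>foldr (anchored_factor y u) js (cutoff f) x\<bar> \<partial>PiM I side)"
    using integral_norm_bound_ennreal[OF int] by simp
  also have "\<dots> = (\<integral>\<^sup>+y. ennreal \<bar>summand_anchored d y u f x\<bar> \<partial>PiM I side)"
  proof (rule nn_integral_cong_AE)
    show "AE y in PiM I side. ennreal \<bar>foldr (anchored_factor y u) js (cutoff f) x\<bar>
        = ennreal \<bar>summand_anchored d y u f x\<bar>"
      using AE_PiM_side[of I, OF order_refl]
    proof eventually_elim
      case (elim y)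
      then show ?case
        unfolding summand_anchored_def summand_eq_foldr[OF fin] js_def[symmetric]
        by (subst foldr_anchored_factor_cutoff[of js x y u f]) (use js x in auto)
    qed
  qed
  finally show ?thesis .
qed

section \<open>The three norm estimates\<close>

lemma card_Pow_diff:
  assumes "v \<subseteq> u" "u \<subseteq> I"
  shows "of_nat (card (Pow (u - v))) = (2 ^ (card u - card v) :: ennreal)"
proof -
  have "finite u" using finite_subset[OF assms(2)] by simp
  then show ?thesis
    using assms finite_subset[OF assms(1)] by (simp add: card_Pow card_Diff_subset)
qed

lemma average_le_sup_norm:
  assumes "v \<subseteq> I"
  shows "average v g z \<le> sup_norm D g"
proof -
  interpret prob_space "PiM v side"
    using finite_subset[OF assms] by (intro prob_space_PiM_side) simp
  have "average v g z \<le> (\<integral>\<^sup>+t. sup_norm D g \<partial>PiM v side)"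
    unfolding average_def
    by (intro nn_integral_mono) (auto simp: cutoff_def sup_norm_def intro: SUP_upper)
  then show ?thesis
    by (simp add: emeasure_space_1)
qed

text \<open>A uniform point whose v-coordinates are resampled independently is again
  uniform.\<close>

lemma nn_integral_average:
  assumes "continuous_on D g" "v \<subseteq> I"
  shows "(\<integral>\<^sup>+z. average v g z \<partial>PiM I side) = (\<integral>\<^sup>+z. ennreal \<bar>cutoff g z\<bar> \<partial>PiM I side)"
proof -
  have "I - (I - v) = v" "finite v" using assms(2) finite_subset[OF assms(2)] by auto
  moreover have "(\<lambda>z. ennreal \<bar>cutoff g z\<bar>) \<in> borel_measurable (PiM I side)"
    using measurable_cutoff[OF assms(1)] by measurable
  ultimately show ?thesis
    unfolding average_def
    using sides.nn_integral_PiM_merge[of I v "I - v" "\<lambda>z. ennreal \<bar>cutoff g z\<bar>"] by auto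
qed

lemma nn_integral_cutoff_le:
  "(\<integral>\<^sup>+z. ennreal \<bar>cutoff g z\<bar> \<partial>PiM I side) \<le> L1_norm (normalized_lebesgue a b I) g"
  unfolding L1_norm_def normalized_lebesgue_eq_PiM[OF order_refl]
  by (intro nn_integral_mono) (simp add: cutoff_def)

context
  fixes u v :: "nat set" and f :: "point \<Rightarrow> real"
  assumes vu: "v \<subseteq> u" and uI: "u \<subseteq> I" and C_k: "C_k (card v) d a b f"
begin

lemma vI: "v \<subseteq> I"
  using vu uI by (rule order_trans)

abbreviation "vol \<equiv> emeasure (lebesgue_on_coords v) (subbox a b v)"

text \<open>The supremum norm dominates every average, and the number of averages is the number of
  subsets of u - v.\<close>

lemma summand_anchored_le:
  assumes "x \<in> D" "y \<in> D"
  shows "ennreal \<bar>summand_anchored d y u f x\<bar>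
    \<le> 2 ^ (card u - card v) * sup_norm D (mixed_deriv a b v f) * vol"
proof -
  have "ennreal \<bar>summand_anchored d y u f x\<bar>
      \<le> (\<Sum>w\<in>Pow (u - v). vol
        * average v (mixed_deriv a b v f) (merge (u - w) (I - (u - w)) (x, y)))"
    using summand_anchored_le_averages[OF C_k vu uI assms] emeasure_subbox(1)[OF vI] by simp
  also have "\<dots> \<le> (\<Sum>w\<in>Pow (u - v). vol * sup_norm D (mixed_deriv a b v f))"
    by (intro sum_mono mult_left_mono average_le_sup_norm vI) simp
  also have "\<dots> = 2 ^ (card u - card v) * sup_norm D (mixed_deriv a b v f) * vol"
    using card_Pow_diff[OF vu uI] by (simp only: sum_constant mult_ac)
  finally show ?thesis .
qed

text \<open>The anchored bound is uniform in the anchor, so it survives averaging over a probability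
  measure.\<close>

lemma summand_anova_le:
  assumes "x \<in> D"
  shows "ennreal \<bar>summand_anova d a b u f x\<bar>
    \<le> 2 ^ (card u - card v) * sup_norm D (mixed_deriv a b v f) * vol"
proof -
  interpret prob_space "PiM I side" by (rule prob_space_PiM_side) simp
  have cont: "continuous_on D f" using C_k by (cases "card v") auto
  have "ennreal \<bar>summand_anova d a b u f x\<bar>
      \<le> (\<integral>\<^sup>+y. ennreal \<bar>summand_anchored d y u f x\<bar> \<partial>PiM I side)"
    by (rule summand_anova_le_nn_integral[OF cont uI assms])
  also have "\<dots> \<le> (\<integral>\<^sup>+y. 2 ^ (card u - card v) * sup_norm D (mixed_deriv a b v f) * vol \<partial>PiM I side)"
  proof (rule nn_integral_mono_AE)
    show "AE y in PiM I side. ennreal \<bar>summand_anchored d y u f x\<bar>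
        \<le> 2 ^ (card u - card v) * sup_norm D (mixed_deriv a b v f) * vol"
      using AE_PiM_side[OF order_refl] by eventually_elim (rule summand_anchored_le[OF assms])
  qed
  also have "\<dots> = 2 ^ (card u - card v) * sup_norm D (mixed_deriv a b v f) * vol"
    by (simp only: nn_integral_const emeasure_space_1 mult_1_right)
  finally show ?thesis .
qed

text \<open>The bound by averages is integrated over independent uniform x in D_u and y in D. For
  each w the mixed point is uniform on D, so all terms have the same integral.\<close>

lemma L1_norm_summand_anova_le:
  "L1_norm (normalized_lebesgue a b u) (on_subbox d a u (summand_anova d a b u f))
    \<le> 2 ^ (card u - card v) * L1_norm (normalized_lebesgue a b I) (mixed_deriv a b v f) * vol"
proof -
  interpret PI: prob_space "PiM I side" by (rule prob_space_PiM_side) simp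
  have fin: "finite u" using finite_subset[OF uI] by simp
  have cont: "continuous_on D f" using C_k by (cases "card v") auto
  let ?g = "mixed_deriv a b v f"
  define q where "q w p = average v ?g (merge (u - w) (I - (u - w)) p)" for w p
  have g: "continuous_on D ?g" by (rule continuous_mixed_deriv[OF C_k vI])
  have S: "u - w \<subseteq> I" "u - w \<subseteq> u" "I - (u - w) \<subseteq> I" for w
    using uI by auto
  have q: "q w \<in> borel_measurable (PiM u side \<Otimes>\<^sub>M PiM I side)" for w
    unfolding q_def
    by (rule measurable_compose[OF sides.distr_PiM_merge(1) measurable_average[OF g vI]])
      (use S fin in auto)
  have q1: "(\<lambda>y. q w (x, y)) \<in> borel_measurable (PiM I side)" if "x \<in> space (PiM u side)" for w x
    by (rule measurable_compose[OF measurable_Pair1'[OF that] q])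
  have q2: "(\<lambda>x. \<integral>\<^sup>+y. q w (x, y) \<partial>PiM I side) \<in> borel_measurable (PiM u side)" for w
    by (rule PI.borel_measurable_nn_integral_fst[OF q])
  have "L1_norm (normalized_lebesgue a b u) (on_subbox d a u (summand_anova d a b u f))
      = (\<integral>\<^sup>+x. ennreal \<bar>summand_anova d a b u f (merge u (I - u) (x, a))\<bar> \<partial>PiM u side)"
    by (simp only: L1_norm_def normalized_lebesgue_eq_PiM[OF uI] on_subbox_def)
  also have "\<dots> \<le> (\<integral>\<^sup>+x. \<integral>\<^sup>+y. (\<Sum>w\<in>Pow (u - v). vol * q w (x, y)) \<partial>PiM I side \<partial>PiM u side)"
  proof (rule nn_integral_mono_AE)
    show "AE x in PiM u side. ennreal \<bar>summand_anova d a b u f (merge u (I - u) (x, a))\<bar>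
        \<le> (\<integral>\<^sup>+y. (\<Sum>w\<in>Pow (u - v). vol * q w (x, y)) \<partial>PiM I side)"
      using AE_PiM_side[OF uI]
    proof eventually_elim
      case (elim x)
      define x' where "x' = merge u (I - u) (x, a)"
      have x': "x' \<in> D"
        unfolding x'_def subbox_def
      proof (rule PiE_I)
        fix i assume "i \<in> I"
        then show "merge u (I - u) (x, a) i \<in> {a i..b i}"
          using elim less[of i] by (auto simp: merge_def subbox_def PiE_iff)
      qed (use uI in \<open>auto simp: merge_def\<close>)
      have "ennreal \<bar>summand_anova d a b u f x'\<bar>
          \<le> (\<integral>\<^sup>+y. ennreal \<bar>summand_anchored d y u f x'\<bar> \<partial>PiM I side)"
        by (rule summand_anova_le_nn_integral[OF cont uI x'])
      also have "\<dots> \<le> (\<integral>\<^sup>+y. (\<Sum>w\<in>Pow (u - v). vol * q w (x, y)) \<partial>PiM I side)"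
      proof (rule nn_integral_mono_AE)
        show "AE y in PiM I side. ennreal \<bar>summand_anchored d y u f x'\<bar>
            \<le> (\<Sum>w\<in>Pow (u - v). vol * q w (x, y))"
          using AE_PiM_side[OF order_refl]
        proof eventually_elim
          case (elim y)
          \<comment> \<open>On u - w the points \<open>x'\<close> and x agree, and all other
            coordinates come from y; the filling by the corner a disappears.\<close>
          have "merge (u - w) (I - (u - w)) (x', y) = merge (u - w) (I - (u - w)) (x, y)" for w
            by (auto simp: x'_def merge_def fun_eq_iff)
          then show ?case
            using summand_anchored_le_averages[OF C_k vu uI x' elim]
            by (simp only: emeasure_subbox(1)[OF vI] q_def)
        qed
      qed
      finally show ?case by (simp only: x'_def)
    qed
  qed
  also have "\<dots> = (\<integral>\<^sup>+x. (\<Sum>w\<in>Pow (u - v). vol * (\<integral>\<^sup>+y. q w (x, y) \<partial>PiM I side)) \<partial>PiM u side)"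
    using q1 by (intro nn_integral_cong) (simp add: nn_integral_sum nn_integral_cmult)
  also have "\<dots> = (\<Sum>w\<in>Pow (u - v). vol * (\<integral>\<^sup>+x. \<integral>\<^sup>+y. q w (x, y) \<partial>PiM I side \<partial>PiM u side))"
    using q2 by (simp add: nn_integral_sum nn_integral_cmult)
  \<comment> \<open>The double integral over x and y collapses to one over D, independently of
    w.\<close>
  also have "\<dots> = (\<Sum>w\<in>Pow (u - v). vol * (\<integral>\<^sup>+z. average v ?g z \<partial>PiM I side))"
  proof (intro sum.cong refl arg_cong2[where f = "(*)"])
    fix w
    show "(\<integral>\<^sup>+x. \<integral>\<^sup>+y. q w (x, y) \<partial>PiM I side \<partial>PiM u side) = (\<integral>\<^sup>+z. average v ?g z \<partial>PiM I side)"
      unfolding q_def using S fin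
      by (intro sides.nn_integral_PiM_merge measurable_average[OF g vI]) auto
  qed
  also have "\<dots> \<le> (\<Sum>w\<in>Pow (u - v). vol * L1_norm (normalized_lebesgue a b I) ?g)"
    unfolding nn_integral_average[OF g vI]
    by (intro sum_mono mult_left_mono nn_integral_cutoff_le) simp
  also have "\<dots> = 2 ^ (card u - card v) * L1_norm (normalized_lebesgue a b I) ?g * vol"
    using card_Pow_diff[OF vu uI] by (simp only: sum_constant mult_ac)
  finally show ?thesis .
qed

end

end

theorem theorem2p6:
  fixes d :: nat and a b c :: "nat \<Rightarrow> real" and f :: "(nat \<Rightarrow> real) \<Rightarrow> real"
    and u v :: "nat set"
  assumes "\<And>i. i \<in> {1..d} \<Longrightarrow> a i < b i"
    and "v \<subseteq> u" and "u \<subseteq> {1..d}"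
    and "C_k (card v) d a b f"
    and "c \<in> subbox a b {1..d}"
  shows "(sup_norm (subbox a b {1..d}) (summand_anchored d c u f)
           \<le> 2 ^ (card u - card v)
             * sup_norm (subbox a b {1..d}) (mixed_deriv a b v f)
             * emeasure (lebesgue_on_coords v) (subbox a b v))
    \<and> (sup_norm (subbox a b {1..d}) (summand_anova d a b u f)
           \<le> 2 ^ (card u - card v)
             * sup_norm (subbox a b {1..d}) (mixed_deriv a b v f)
             * emeasure (normalized_lebesgue a b {1..d}) (subbox a b {1..d})
             * emeasure (lebesgue_on_coords v) (subbox a b v))
    \<and> (L1_norm (normalized_lebesgue a b u) (on_subbox d a u (summand_anova d a b u f))
           \<le> 2 ^ (card u - card v)
             * L1_norm (normalized_lebesgue a b {1..d}) (mixed_deriv a b v f)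
             * emeasure (normalized_lebesgue a b u) (subbox a b u)
             * emeasure (lebesgue_on_coords v) (subbox a b v))"
proof -
  interpret anova_box d a b using assms(1) by unfold_locales
  have u: "u \<subseteq> {1..d}" and v: "v \<subseteq> u" by fact+
  \<comment> \<open>The normalized factors in (ii) and (iii) equal one, so the estimates above,
    which contain only the ordinary volume of D_v, already have the required form.\<close>
  have one: "emeasure (normalized_lebesgue a b w) (subbox a b w) = 1" if "w \<subseteq> {1..d}" for w
    using assms(1) that finite_subset[OF that] by (intro emeasure_normalized_lebesgue_subbox) auto
  note C_k = assms(4)
  have "sup_norm D (summand_anchored d c u f)
      \<le> 2 ^ (card u - card v) * sup_norm D (mixed_deriv a b v f)
        * emeasure (lebesgue_on_coords v) (subbox a b v)"
    unfolding sup_norm_def[of _ "summand_anchored d c u f"]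
    by (rule SUP_least) (rule summand_anchored_le[OF v u C_k _ assms(5)])
  moreover have "sup_norm D (summand_anova d a b u f)
      \<le> 2 ^ (card u - card v) * sup_norm D (mixed_deriv a b v f)
        * emeasure (lebesgue_on_coords v) (subbox a b v)"
    unfolding sup_norm_def[of _ "summand_anova d a b u f"]
    by (rule SUP_least) (rule summand_anova_le[OF v u C_k])
  ultimately show ?thesis
    using L1_norm_summand_anova_le[OF v u C_k]
    by (simp only: one[OF u] one[OF order_refl] mult_1_right simp_thms)
qed

end
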